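(* Let $W$ be a finite set, let $0\le k\le d$ be integers, and let $\Sigma=(\mathcal{K},\mathscr{L})$ be a $(d-k)$-admissible selection structure on $W$. Suppose that for each $w\in W$ we have a closed convex set $F_w\subseteq\mathbb{R}^d$, and that for every $\sigma\in\mathcal{K}$ the intersection $\bigcap_{w\in\sigma}F_w$ contains a $k$-flat. Then there exists $W'\subseteq W$ such that $W\setminus W'\notin\mathscr{L}$ and $\bigcap_{w\in W'}F_w$ contains a $k$-flat.
   Context: A $k$-flat in $\mathbb{R}^d$ is a $k$-dimensional affine subspace (a $0$-flat is a point). The intersection indexed by the empty set is $\mathbb{R}^d$. Let $W$ be a finite set and $\mathcal{K}$ a simplicial complex with vertices in $W$. For $U\subseteq W$, let $\mathcal{K}[U]=\{\sigma\cap U:\sigma\in\mathcal{K}\}$ be the restriction of $\mathcal{K}$ to $U$. If $D=\{D_w:w\in W\}$ is an indexed family of non-empty finite sets, define $$\mathcal{K}(U;D)=\bigcup_{\sigma\in\mathcal{K}[U]}\Big(\mathop{\ast}_{w\in\sigma}D_w\Big),$$ where $\ast$ denotes the iterated join of the sets $D_w$, each regarded as a discrete ($0$-dimensional) complex. Equivalently, $\mathcal{K}(U;D)$ is the simplicial complex with vertices among the pairs $(w,x)$, $w\in U$, $x\in D_w$, whose faces are the sets $\{(w,x_w):w\in\sigma\}$ with $\sigma\in\mathcal{K}[U]$ and $x_w\in D_w$ for each $w\in\sigma$. For a non-negative integer $m$, an $m$-admissible selection structure $\Sigma=(\mathcal{K},\mathscr{L})$ on $W$ is a pair in which $\mathcal{K}$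 is a simplicial complex on $W$ and $\mathscr{L}$ is a non-empty upward-closed family of subsets of $W$ with the following two properties: (1) for every indexed family $D=\{D_w:w\in W\}$ of non-empty finite sets and every $U\in\mathscr{L}$, the complex $\mathcal{K}(U;D)$ is $(m-1)$-connected (where $(-1)$-connected means non-empty, i.e. having at least one vertex); (2) for every $U\in\mathscr{L}$, every facet (inclusion-maximal face) of $\mathcal{K}[U]$ is a facet of $\mathcal{K}$. *)

theory Defs
  imports "HOL-Analysis.Analysis"
begin

section \<open>Finite simplicial complexes\<close>

text \<open>
  A complex is its set of faces. The empty set is a face of every complex that has any faces at all.
\<close>

definition simplicial_complex_on :: "'v set \<Rightarrow> 'v set set \<Rightarrow> bool" where
  "simplicial_complex_on W K \<longleftrightarrow>
     (\<forall>\<sigma>\<in>K. finite \<sigma> \<and> \<sigma> \<subseteq> W) \<and> (\<forall>\<sigma>\<in>K. \<forall>\<tau>\<subseteq>\<sigma>. \<tau> \<in> K)"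

definition facet :: "'v set set \<Rightarrow> 'v set \<Rightarrow> bool" where
  "facet K \<sigma> \<longleftrightarrow> \<sigma> \<in> K \<and> (\<forall>\<tau>\<in>K. \<sigma> \<subseteq> \<tau> \<longrightarrow> \<tau> = \<sigma>)"

definition restrict_complex :: "'v set set \<Rightarrow> 'v set \<Rightarrow> 'v set set" where
  "restrict_complex K U = {\<sigma> \<inter> U | \<sigma>. \<sigma> \<in> K}"

definition discrete_complex :: "'x set \<Rightarrow> 'x set set" where
  "discrete_complex X = insert {} {{x} | x. x \<in> X}"

text \<open>
  Vertices are tagged by their index, so that the vertex sets of the factors are disjoint; a face
  of the join is a disjoint union of (possibly empty) faces \<open>\<rho> w\<close> of the factors.
\<close>

definition iterated_join :: "'w set \<Rightarrow> ('w \<Rightarrow> 'x set set) \<Rightarrow> ('w \<times> 'x) set set" where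
  "iterated_join I L = {Sigma I \<rho> | \<rho>. \<forall>w\<in>I. \<rho> w \<in> L w}"

text \<open>The complex written \<open>\<K>(U;D)\<close>.\<close>

definition selection_complex ::
  "'w set set \<Rightarrow> 'w set \<Rightarrow> ('w \<Rightarrow> 'x set) \<Rightarrow> ('w \<times> 'x) set set" where
  "selection_complex K U D =
     (\<Union>\<sigma>\<in>restrict_complex K U. iterated_join \<sigma> (\<lambda>w. discrete_complex (D w)))"


section \<open>Connectivity\<close>

text \<open>
  Points of the geometric realization are given by their barycentric coordinates. The product
  topology is the usual topology of the realization as long as the complex has only finitely many
  vertices, which is the only case in which the definition is used.
\<close>

definition realization :: "'v set set \<Rightarrow> ('v \<Rightarrow> real) topology" where
  "realization K = subtopology (powertop_real UNIV)
     {\<alpha>. (\<forall>v. 0 \<le> \<alpha> v) \<and> {v. \<alpha> v \<noteq> 0} \<in> K \<and> (\<Sum>v | \<alpha> v \<noteq> 0. \<alpha> v) = 1}"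

text \<open>
  A space is \<open>n\<close>-connected if it is non-empty and every map into it from a sphere of dimension
  \<open>0, \<dots>, n\<close> is null-homotopic; for \<open>n = -1\<close> only non-emptiness is left. The \<open>0\<close>-sphere has two
  points, so its instance is path-connectedness.
\<close>

definition n_connected_space :: "int \<Rightarrow> 'a topology \<Rightarrow> bool" where
  "n_connected_space n X \<longleftrightarrow>
     (n \<ge> -1 \<longrightarrow> topspace X \<noteq> {}) \<and>
     (\<forall>i f. int i \<le> n \<and> continuous_map (nsphere i) X f \<longrightarrow>
        (\<exists>c\<in>topspace X. homotopic_with (\<lambda>_. True) (nsphere i) X f (\<lambda>_. c)))"

definition n_connected_complex :: "int \<Rightarrow> 'v set set \<Rightarrow> bool" where
  "n_connected_complex n K \<longleftrightarrow> n_connected_space n (realization K)"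


section \<open>Admissible selection structures\<close>

text \<open>
  The families \<open>D\<close> of non-empty finite sets are taken to consist of sets of natural numbers. This is
  no restriction: every finite set is in bijection with one of these, and bijections between
  the sets \<open>D w\<close> induce isomorphisms of the associated complexes.
\<close>

definition admissible_selection_structure ::
  "nat \<Rightarrow> 'w set \<Rightarrow> 'w set set \<Rightarrow> 'w set set \<Rightarrow> bool" where
  "admissible_selection_structure m W K \<L> \<longleftrightarrow>
     simplicial_complex_on W K \<and>
     \<L> \<noteq> {} \<and> \<L> \<subseteq> Pow W \<and> (\<forall>U\<in>\<L>. \<forall>V. U \<subseteq> V \<and> V \<subseteq> W \<longrightarrow> V \<in> \<L>) \<and>
     (\<forall>D :: 'w \<Rightarrow> nat set. (\<forall>w\<in>W. finite (D w) \<and> D w \<noteq> {}) \<longrightarrow>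
        (\<forall>U\<in>\<L>. n_connected_complex (int m - 1) (selection_complex K U D))) \<and>
     (\<forall>U\<in>\<L>. \<forall>\<sigma>. facet (restrict_complex K U) \<sigma> \<longrightarrow> facet K \<sigma>)"


section \<open>Flats\<close>

definition is_flat :: "nat \<Rightarrow> 'a::euclidean_space set \<Rightarrow> bool" where
  "is_flat k A \<longleftrightarrow> affine A \<and> aff_dim A = int k"

definition contains_flat :: "nat \<Rightarrow> 'a::euclidean_space set \<Rightarrow> bool" where
  "contains_flat k C \<longleftrightarrow> (\<exists>A. is_flat k A \<and> A \<subseteq> C)"

text \<open>
  The ambient space \<open>\<real>\<^sup>d\<close> is given as a \<open>d\<close>-dimensional linear subspace \<open>E\<close> of some Euclidean space
  type. Such types have positive dimension, so taking the whole type would exclude \<open>d = 0\<close>; for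
  \<open>d > 0\<close> one may take \<open>E = UNIV\<close>. Intersecting with \<open>E\<close> makes the intersection over the empty
  set equal to the ambient space.
\<close>

definition intersection_in :: "'a set \<Rightarrow> ('w \<Rightarrow> 'a set) \<Rightarrow> 'w set \<Rightarrow> 'a set" where
  "intersection_in E F I = E \<inter> (\<Inter>w\<in>I. F w)"

end

theory Submission
  imports Defs
begin

text \<open>
  For each face \<open>\<sigma>\<close> of \<open>\<K>\<close> fix a \<open>k\<close>-flat with direction \<open>L \<sigma>\<close> inside the intersection of the \<open>F w\<close>,
  \<open>w \<in> \<sigma>\<close>, and let \<open>V w\<close> be the sum of the \<open>L \<sigma>\<close> with \<open>w \<in> \<sigma>\<close>; then \<open>F w + V w = F w\<close>. Cut everything
  with a \<open>(d - k)\<close>-dimensional affine subspace \<open>M\<close> transversal to all \<open>L \<sigma>\<close>, so that \<open>M\<close> meets the flat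
  of \<open>\<sigma>\<close> in a point \<open>q \<sigma>\<close>, and let \<open>G w\<close> be the polytope spanned by the \<open>q \<sigma>\<close> with \<open>w \<in> \<sigma>\<close>. If \<open>M\<close> is
  moved far away from the origin in a generic direction, then the polytopes \<open>G w\<close>, \<open>w \<in> W'\<close>, which lie
  within bounded distance of the \<open>V w\<close>, can only have a common point when the \<open>V w\<close> intersect in
  dimension at least \<open>k\<close>. This reduces the theorem to the case \<open>k = 0\<close> for the \<open>G w\<close> in \<open>M\<close>.

  For \<open>k = 0\<close>, suppose that the set \<open>U x\<close> of those \<open>w\<close> with \<open>x \<notin> G w\<close> belongs to \<open>\<L>\<close> for every \<open>x\<close>.
  Write every \<open>G w\<close> as a finite intersection of half-spaces and let \<open>D x w\<close> be the set of those that
  exclude \<open>x\<close>. The complexes \<open>\<K>(U x; D x)\<close> are \<open>(d - 1)\<close>-connected and shrink on passing from a cell of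
  the hyperplane arrangement to its faces, so a continuous selection \<open>f\<close> of points in their
  realizations can be built cell by cell. Averaging the inner normals of the half-spaces with the
  weights \<open>f x\<close> gives a vector field on the hull of all \<open>q \<sigma>\<close> that has positive inner product with
  \<open>q \<sigma> - x\<close> for any \<open>\<sigma>\<close> containing all the indices in the support of \<open>f x\<close>. By Brouwer's theorem,
  such a field does not exist.
\<close>

section \<open>Extending maps over convex cells\<close>

text \<open>\<open>S\<close> is a cone over its relative frontier: collapsing the end
  \<open>t = 1\<close> of the cylinder to a relatively interior point \<open>z\<close> is a quotient
  map onto \<open>S\<close>. The null-homotopy is constant at that end, so it descends to
  \<open>S\<close>.\<close>

lemma extend_from_rel_frontier:
  fixes S :: "'a::euclidean_space set"
  assumes "convex S" "compact S" and c: "c \<in> topspace X"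
    and hom: "homotopic_with (\<lambda>_. True) (top_of_set (rel_frontier S)) X f (\<lambda>_. c)"
  obtains g where "continuous_map (top_of_set S) X g" "\<And>x. x \<in> rel_frontier S \<Longrightarrow> g x = f x"
proof (cases "rel_frontier S = {}")
  case True
  then show ?thesis
    using that[of "\<lambda>_. c"] c by auto
next
  case False
  let ?R = "rel_frontier S" and ?I = "{0..1::real}"
  have "S \<noteq> {}" using False by auto
  then obtain z where z: "z \<in> rel_interior S"
    using \<open>convex S\<close> rel_interior_eq_empty by blast
  then have "z \<in> S" using rel_interior_subset by blast
  have "bounded S" "closed S" using \<open>compact S\<close> compact_eq_bounded_closed by auto
  have Rsub: "?R \<subseteq> S" using \<open>closed S\<close> by (simp add: rel_frontier_def Diff_subset)
  have "compact ?R"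
    by (simp add: \<open>bounded S\<close> compact_rel_frontier_bounded)
  obtain h where contk: "continuous_map (prod_topology (top_of_set ?I) (top_of_set ?R)) X h"
    and h0: "\<And>x. h (0, x) = f x" and h1: "\<And>x. h (1, x) = c"
    using hom unfolding homotopic_with_def by blast
  have conth: "continuous_map (top_of_set (?I \<times> ?R)) X h"
    using contk by simp
  define q where "q = (\<lambda>(t, u). (1 - t) *\<^sub>R u + t *\<^sub>R z)"
  have contq: "continuous_on (?I \<times> ?R) q"
    unfolding q_def case_prod_unfold by (intro continuous_intros)
  have imq: "q ` (?I \<times> ?R) = S"
  proof
    show "q ` (?I \<times> ?R) \<subseteq> S"
      using convexD_alt[OF \<open>convex S\<close> _ \<open>z \<in> S\<close>] Rsub by (auto simp: q_def)
    show "S \<subseteq> q ` (?I \<times> ?R)"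
    proof
      fix y assume "y \<in> S"
      show "y \<in> q ` (?I \<times> ?R)"
      proof (cases "y = z")
        case True
        obtain u where "u \<in> ?R" using \<open>?R \<noteq> {}\<close> by blast
        moreover have "y = q (1, u)" using True by (simp add: q_def)
        ultimately show ?thesis by (metis atLeastAtMost_iff image_eqI mem_Sigma_iff order_refl zero_le_one)
      next
        case False
        then obtain u where u: "u \<in> ?R" "y \<in> closed_segment z u"
          using segment_to_rel_frontier_aux[OF \<open>convex S\<close> \<open>bounded S\<close> z \<open>y \<in> S\<close>] by metis
        then obtain t where "0 \<le> t" "t \<le> 1" "y = (1 - t) *\<^sub>R z + t *\<^sub>R u"
          unfolding closed_segment_def by auto
        then have "y = q (1 - t, u)" "1 - t \<in> ?I" by (auto simp: q_def)
        then show ?thesis using u(1) by blast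
      qed
    qed
  qed
  \<comment> \<open>A ray from \<open>z\<close> meets the relative frontier only once: a point
    strictly before another would lie in the relative interior.\<close>
  have scal: "s \<ge> 1" if "u \<in> ?R" "u' \<in> ?R" "u' - z = s *\<^sub>R (u - z)" "s > 0" for u u' s
  proof (rule ccontr)
    assume "\<not> s \<ge> 1"
    moreover have "u \<noteq> z" using that(1) z by (auto simp: rel_frontier_def)
    moreover have "u' = (1 - s) *\<^sub>R z + s *\<^sub>R u" using that(3) by (simp add: algebra_simps)
    ultimately have "u' \<in> open_segment z u"
      using \<open>s > 0\<close> by (auto simp: in_segment)
    moreover have "open_segment z u \<subseteq> rel_interior S"
      using rel_interior_closure_convex_segment[OF \<open>convex S\<close> z] that(1) by (auto simp: rel_frontier_def)
    ultimately show False using that(2) by (auto simp: rel_frontier_def)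
  qed
  have inj: "t = t' \<and> (t = 1 \<or> u = u')"
    if "u \<in> ?R" "u' \<in> ?R" "t \<le> 1" "t' \<le> 1" and eq: "q (t, u) = q (t', u')" for t t' u u'
  proof -
    have e: "(1 - t) *\<^sub>R (u - z) = (1 - t') *\<^sub>R (u' - z)"
      using eq by (simp add: q_def algebra_simps)
    have ne: "u - z \<noteq> 0" "u' - z \<noteq> 0" using that(1,2) z by (auto simp: rel_frontier_def)
    show ?thesis
    proof (cases "t = 1 \<or> t' = 1")
      case True
      then show ?thesis using e ne by auto
    next
      case False
      then have pos: "1 - t > 0" "1 - t' > 0" using that by auto
      have "u' - z = ((1 - t) / (1 - t')) *\<^sub>R (u - z)" "u - z = ((1 - t') / (1 - t)) *\<^sub>R (u' - z)"
        using arg_cong[OF e, of "\<lambda>v. (1 / (1 - t')) *\<^sub>R v"] arg_cong[OF e, of "\<lambda>v. (1 / (1 - t)) *\<^sub>R v"] pos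
        by auto
      then have "(1 - t) / (1 - t') \<ge> 1" "(1 - t') / (1 - t) \<ge> 1"
        using scal[OF that(1,2)] scal[OF that(2,1)] pos by auto
      then have "t = t'" using pos by (simp add: field_simps)
      then show ?thesis using e pos by auto
    qed
  qed
  have quot: "quotient_map (top_of_set (?I \<times> ?R)) (top_of_set S) q"
  proof (rule continuous_closed_imp_quotient_map)
    show "continuous_map (top_of_set (?I \<times> ?R)) (top_of_set S) q"
      using contq imq by auto
    show "closed_map (top_of_set (?I \<times> ?R)) (top_of_set S) q"
    proof (rule continuous_imp_closed_map)
      show "compact_space (top_of_set (?I \<times> ?R))"
        using \<open>compact ?R\<close> by (simp add: compact_space_subtopology compact_Times)
    qed (use contq imq in \<open>auto simp: Hausdorff_space_subtopology\<close>)
  qed (use imq in auto)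
  obtain g where g: "continuous_map (top_of_set S) X g" "\<And>x. x \<in> ?I \<times> ?R \<Longrightarrow> g (q x) = h x"
  proof (rule quotient_map_lift_exists[OF quot conth])
    fix x y assume "x \<in> topspace (top_of_set (?I \<times> ?R))" "y \<in> topspace (top_of_set (?I \<times> ?R))" "q x = q y"
    moreover obtain t u t' u' where "x = (t, u)" "y = (t', u')" by (meson surj_pair)
    ultimately show "h x = h y"
      using inj[of u u' t t'] h1 by auto
  qed auto
  show ?thesis
  proof (rule that[OF g(1)])
    fix x assume "x \<in> ?R"
    then show "g x = f x" using g(2)[of "(0, x)"] h0 by (simp add: q_def)
  qed
qed

lemma homeomorphic_unit_sphere_nsphere:
  fixes T :: "'a::euclidean_space set"
  assumes "subspace T" "dim T = Suc i"
  shows "top_of_set (sphere 0 1 \<inter> T) homeomorphic_space nsphere i"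
proof -
  obtain B where B: "B \<subseteq> T" "pairwise orthogonal B" "\<And>x. x \<in> B \<Longrightarrow> norm x = 1"
    "independent B" "card B = dim T" "span B = T"
    using orthonormal_basis_subspace[OF assms(1)] by metis
  have "finite B" using B(4) by (rule independent_imp_finite)
  then obtain b where b: "bij_betw b {..i} B"
    using finite_same_card_bij[of "{..i}" B] B(5) assms(2) by auto
  have bB: "b j \<in> B" if "j \<le> i" for j using b that by (auto simp: bij_betw_def)
  have bb: "b j \<bullet> b l = (if j = l then 1 else 0)" if "j \<le> i" "l \<le> i" for j l
  proof (cases "j = l")
    case True then show ?thesis using B(3)[OF bB[OF that(1)]] by (simp add: dot_square_norm)
  next
    case False
    then have "b j \<noteq> b l" using b that by (auto simp: bij_betw_def inj_on_def)
    then show ?thesis using B(2) bB that False by (auto simp: pairwise_def orthogonal_def)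
  qed
  have expand: "(\<Sum>j\<le>i. (x \<bullet> b j) *\<^sub>R b j) = x" if "x \<in> T" for x
  proof -
    have "(\<Sum>v\<in>B. (x \<bullet> v) *\<^sub>R v) = x"
      using orthonormal_basis_expand[OF B(2,3) _ \<open>finite B\<close>] that B(6) by simp
    then show ?thesis
      using sum.reindex_bij_betw[OF b, of "\<lambda>v. (x \<bullet> v) *\<^sub>R v"] by simp
  qed
  have coord: "(\<Sum>j\<le>i. v j *\<^sub>R b j) \<bullet> b l = v l" if "l \<le> i" for v :: "nat \<Rightarrow> real" and l
  proof -
    have "(\<Sum>j\<le>i. v j *\<^sub>R b j) \<bullet> b l = (\<Sum>j\<le>i. if j = l then v l else 0)"
      unfolding inner_sum_left by (rule sum.cong) (use that in \<open>auto simp: bb\<close>)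
    then show ?thesis using that by simp
  qed
  have nrm: "(norm x)\<^sup>2 = (\<Sum>j\<le>i. (x \<bullet> b j)\<^sup>2)" if "x \<in> T" for x
  proof -
    have "(norm x)\<^sup>2 = x \<bullet> (\<Sum>j\<le>i. (x \<bullet> b j) *\<^sub>R b j)" using expand[OF that] by (simp add: dot_square_norm)
    then show ?thesis by (simp add: inner_sum_right power2_eq_square)
  qed
  have inT: "(\<Sum>j\<le>i. v j *\<^sub>R b j) \<in> T" for v :: "nat \<Rightarrow> real"
    by (intro subspace_sum subspace_scale assms(1)) (use bB B(1) in auto)
  define f where "f = (\<lambda>x j. if j \<le> i then x \<bullet> b j else 0)"
  define g where "g = (\<lambda>v. \<Sum>j\<le>i. v j *\<^sub>R b j)"
  let ?N = "{x :: nat \<Rightarrow> real. (\<Sum>j\<le>i. x j ^ 2) = 1 \<and> (\<forall>j>i. x j = 0)}"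
  have top: "nsphere i = top_of_set ?N"
    by (simp add: nsphere euclidean_product_topology)
  have "homeomorphic_maps (top_of_set (sphere 0 1 \<inter> T)) (nsphere i) f g"
    unfolding homeomorphic_maps_def top
  proof (intro conjI ballI)
    have "continuous_on UNIV (\<lambda>x. f x j)" for j
      unfolding f_def by (cases "j \<le> i") (auto intro!: continuous_intros)
    then have "continuous_on UNIV f"
      by (intro continuous_on_coordinatewise_then_product)
    moreover have "f x \<in> ?N" if "x \<in> sphere 0 1 \<inter> T" for x
      using nrm[of x] that by (simp add: f_def)
    ultimately show "continuous_map (top_of_set (sphere 0 1 \<inter> T)) (top_of_set ?N) f"
      by (auto intro: continuous_on_subset)
    have "continuous_on UNIV g" unfolding g_def
      by (intro continuous_intros continuous_on_product_then_coordinatewise[OF continuous_on_id])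
    moreover have "g v \<in> sphere 0 1 \<inter> T" if "v \<in> ?N" for v
    proof -
      have "(norm (g v))\<^sup>2 = 1" using nrm[OF inT[of v]] that by (simp add: g_def coord)
      then show ?thesis
        using abs_square_eq_1[of "norm (g v)"] inT[of v] by (simp add: g_def)
    qed
    ultimately show "continuous_map (top_of_set ?N) (top_of_set (sphere 0 1 \<inter> T)) g"
      by (auto intro: continuous_on_subset)
    fix x assume "x \<in> topspace (top_of_set (sphere 0 1 \<inter> T))"
    then show "g (f x) = x" using expand[of x] by (simp add: f_def g_def)
  next
    fix v assume "v \<in> topspace (top_of_set ?N)"
    then have "f (g v) j = v j" for j by (cases "j \<le> i") (simp_all add: f_def g_def coord)
    then show "f (g v) = v" by blast
  qed
  then show ?thesis unfolding homeomorphic_space_def by blast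
qed

lemma homeomorphic_rel_frontier_nsphere:
  fixes S :: "'a::euclidean_space set"
  assumes "convex S" "bounded S" "aff_dim S = int (Suc i)"
  shows "top_of_set (rel_frontier S) homeomorphic_space nsphere i"
proof -
  have "aff_dim S \<le> int (dim (UNIV :: 'a set))" by (simp add: aff_dim_le_DIM)
  moreover have "S \<noteq> {}" using assms(3) by auto
  ultimately obtain T :: "'a set" where T: "subspace T" "aff_dim T = aff_dim S"
    "rel_frontier S homeomorphic (sphere 0 1 \<inter> T)"
    using spheremap_lemma3[OF assms(2,1) subspace_UNIV] by metis
  then have "dim T = Suc i" using assms(3) aff_dim_subspace[of T] by simp
  moreover obtain f g where "homeomorphism (rel_frontier S) (sphere 0 1 \<inter> T) f g"
    using T(3) unfolding homeomorphic_def by blast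
  then have "homeomorphic_maps (top_of_set (rel_frontier S)) (top_of_set (sphere 0 1 \<inter> T)) f g"
    unfolding homeomorphism_def homeomorphic_maps_def by auto
  then have "top_of_set (rel_frontier S) homeomorphic_space top_of_set (sphere 0 1 \<inter> T)"
    unfolding homeomorphic_space_def by blast
  ultimately show ?thesis
    using homeomorphic_unit_sphere_nsphere[OF T(1)] homeomorphic_space_trans by blast
qed

text \<open>The relative frontier of a cell of dimension \<open>i + 1\<close> is an
  \<open>i\<close>-sphere, and \<open>i + 1 \<le> n\<close> puts it in the range where the
  connectivity of \<open>X\<close> yields a null-homotopy.\<close>

lemma n_connected_extend_cell:
  fixes S :: "'a::euclidean_space set"
  assumes X: "n_connected_space (int n - 1) X"
    and S: "convex S" "compact S" "aff_dim S \<le> int n"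
    and f: "continuous_map (top_of_set (rel_frontier S)) X f"
  obtains g where "continuous_map (top_of_set S) X g" "\<And>x. x \<in> rel_frontier S \<Longrightarrow> g x = f x"
proof (cases "aff_dim S \<le> 0")
  \<comment> \<open>In dimension at most 0 the relative frontier is empty, so any constant map
    works.\<close>
  case True
  have "topspace X \<noteq> {}" using X unfolding n_connected_space_def by simp
  then obtain c where "c \<in> topspace X" by blast
  moreover have "rel_frontier S = {}"
  proof (cases "S = {}")
    case False
    then have "aff_dim S = 0" using True aff_dim_negative_iff[of S] by linarith
    then show ?thesis by (auto simp: aff_dim_eq_0)
  qed auto
  ultimately show ?thesis using that[of "\<lambda>_. c"] by auto
next
  case False
  define i where "i = nat (aff_dim S) - 1"
  have i: "aff_dim S = int (Suc i)" using False by (simp add: i_def)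
  have "bounded S" using S(2) by (rule compact_imp_bounded)
  then obtain h k where hk: "homeomorphic_maps (top_of_set (rel_frontier S)) (nsphere i) h k"
    using homeomorphic_rel_frontier_nsphere[OF S(1) _ i] unfolding homeomorphic_space_def by blast
  then have "continuous_map (nsphere i) X (f \<circ> k)"
    using f by (auto simp: homeomorphic_maps_def intro: continuous_map_compose)
  moreover have "int i \<le> int n - 1" using i S(3) by simp
  ultimately obtain c where c: "c \<in> topspace X" "homotopic_with (\<lambda>_. True) (nsphere i) X (f \<circ> k) (\<lambda>_. c)"
    using X unfolding n_connected_space_def by blast
  have "homotopic_with (\<lambda>_. True) (top_of_set (rel_frontier S)) X ((f \<circ> k) \<circ> h) ((\<lambda>_. c) \<circ> h)"
    using hk by (intro homotopic_with_compose_continuous_map_right[OF c(2)]) (auto simp: homeomorphic_maps_def)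
  then have "homotopic_with (\<lambda>_. True) (top_of_set (rel_frontier S)) X f (\<lambda>_. c)"
    by (rule homotopic_with_eq) (use hk in \<open>auto simp: homeomorphic_maps_def\<close>)
  then show ?thesis
    using extend_from_rel_frontier[OF S(1,2) c(1)] that by metis
qed

section \<open>Selections over hyperplane arrangements\<close>

text \<open>The closed face of the arrangement of hyperplanes \<open>a j \<bullet> y = b j\<close>
  that has \<open>x\<close> in its relative interior. Indexing faces by points turns the face
  relation into membership: \<open>y\<close> lies in the cell of \<open>x\<close> exactly when the
  cell of \<open>y\<close> is a face of it.\<close>

definition arrangement_cell :: "'i set \<Rightarrow> ('i \<Rightarrow> 'a::euclidean_space) \<Rightarrow> ('i \<Rightarrow> real) \<Rightarrow> 'a \<Rightarrow> 'a set" where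
  "arrangement_cell J a b x =
     {y. \<forall>j\<in>J. (a j \<bullet> x \<le> b j \<longrightarrow> a j \<bullet> y \<le> b j) \<and> (b j \<le> a j \<bullet> x \<longrightarrow> b j \<le> a j \<bullet> y)}"

lemma arrangement_cell_refl: "x \<in> arrangement_cell J a b x"
  by (simp add: arrangement_cell_def)

lemma arrangement_cell_mono:
  "y \<in> arrangement_cell J a b x \<Longrightarrow> arrangement_cell J a b y \<subseteq> arrangement_cell J a b x"
  by (auto simp: arrangement_cell_def)

lemma arrangement_cell_altdef:
  "arrangement_cell J a b x =
     (\<Inter>j\<in>{j\<in>J. a j \<bullet> x \<le> b j}. {y. a j \<bullet> y \<le> b j}) \<inter> (\<Inter>j\<in>{j\<in>J. b j \<le> a j \<bullet> x}. {y. a j \<bullet> y \<ge> b j})"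
  by (auto simp: arrangement_cell_def)

lemma convex_arrangement_cell: "convex (arrangement_cell J a b x)"
  unfolding arrangement_cell_altdef
  by (intro convex_Int convex_INT convex_halfspace_le convex_halfspace_ge)

lemma closed_arrangement_cell: "closed (arrangement_cell J a b x)"
  unfolding arrangement_cell_altdef
  by (intro closed_Int closed_INT ballI closed_halfspace_le closed_halfspace_ge)

lemma finite_arrangement_cells:
  assumes "finite J"
  shows "finite (arrangement_cell J a b ` A)"
proof (rule finite_subset)
  let ?f = "\<lambda>(P, Q). (\<Inter>j\<in>P. {y. a j \<bullet> y \<le> b j}) \<inter> (\<Inter>j\<in>Q. {y. a j \<bullet> y \<ge> b j})"
  show "finite (?f ` (Pow J \<times> Pow J))" using assms by simp
  show "arrangement_cell J a b ` A \<subseteq> ?f ` (Pow J \<times> Pow J)"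
  proof (rule image_subsetI)
    fix x assume "x \<in> A"
    show "arrangement_cell J a b x \<in> ?f ` (Pow J \<times> Pow J)"
      by (rule image_eqI[where x = "({j\<in>J. a j \<bullet> x \<le> b j}, {j\<in>J. b j \<le> a j \<bullet> x})"])
        (auto simp: arrangement_cell_altdef)
  qed
qed

text \<open>The relative interior consists of the points with the same sign pattern as
  \<open>x\<close>. The segment from \<open>x\<close> to a relatively interior \<open>y\<close> can
  be prolonged within the cell, so no hyperplane contains \<open>y\<close> but not \<open>x\<close>.
  Conversely, equalities at \<open>x\<close> persist on the affine hull and strict inequalities are
  open conditions.\<close>

lemma rel_frontier_arrangement_cell:
  assumes "finite J"
  shows "rel_frontier (arrangement_cell J a b x) =
    {y \<in> arrangement_cell J a b x. x \<notin> arrangement_cell J a b y}"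
proof -
  let ?C = "arrangement_cell J a b"
  have "y \<in> rel_interior (?C x) \<longleftrightarrow> x \<in> ?C y" if y: "y \<in> ?C x" for y
  proof
    assume "y \<in> rel_interior (?C x)"
    then obtain e where e: "e > 1" "(1 - e) *\<^sub>R x + e *\<^sub>R y \<in> ?C x"
      using convex_rel_interior_iff[OF convex_arrangement_cell, of J a b x y] arrangement_cell_refl
      by blast
    show "x \<in> ?C y"
      unfolding arrangement_cell_def
    proof (intro CollectI ballI)
      fix j assume j: "j \<in> J"
      define s where "s = a j \<bullet> x - b j"
      define t where "t = a j \<bullet> y - b j"
      have "a j \<bullet> ((1 - e) *\<^sub>R x + e *\<^sub>R y) - b j = s + e * (t - s)"
        by (simp add: s_def t_def inner_simps algebra_simps)
      then have *: "s \<le> 0 \<Longrightarrow> s + e * (t - s) \<le> 0" "s \<ge> 0 \<Longrightarrow> s + e * (t - s) \<ge> 0"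
        "s \<le> 0 \<Longrightarrow> t \<le> 0" "s \<ge> 0 \<Longrightarrow> t \<ge> 0"
        using e(2) y j by (auto simp: arrangement_cell_def s_def t_def)
      have "s \<le> 0" if "t \<le> 0"
      proof (rule ccontr)
        assume s: "\<not> s \<le> 0"
        have "e * (t - s) \<le> e * (- s)" using e(1) that by (intro mult_left_mono) auto
        moreover have "1 * s < e * s" using e(1) s by (intro mult_strict_right_mono) auto
        moreover have "s + e * (t - s) \<ge> 0" using *(2) s by auto
        ultimately show False by linarith
      qed
      moreover have "s \<ge> 0" if "t \<ge> 0"
      proof (rule ccontr)
        assume s: "\<not> s \<ge> 0"
        have "e * (t - s) \<ge> e * (- s)" using e(1) that by (intro mult_left_mono) auto
        moreover have "1 * (- s) < e * (- s)" using e(1) s by (intro mult_strict_right_mono) auto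
        moreover have "s + e * (t - s) \<le> 0" using *(1) s by auto
        ultimately show False by linarith
      qed
      ultimately show "(a j \<bullet> y \<le> b j \<longrightarrow> a j \<bullet> x \<le> b j) \<and> (b j \<le> a j \<bullet> y \<longrightarrow> b j \<le> a j \<bullet> x)"
        by (simp add: s_def t_def)
    qed
  next
    assume x: "x \<in> ?C y"
    define U where "U = (\<Inter>j\<in>{j\<in>J. a j \<bullet> x < b j}. {z. a j \<bullet> z < b j}) \<inter>
      (\<Inter>j\<in>{j\<in>J. b j < a j \<bullet> x}. {z. a j \<bullet> z > b j})"
    have "open U"
      unfolding U_def using assms
      by (intro open_Int open_INT ballI open_halfspace_lt open_halfspace_gt) auto
    moreover have "y \<in> U"
      using x y unfolding U_def arrangement_cell_def by (force simp: not_le[symmetric])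
    moreover have "U \<inter> affine hull ?C x \<subseteq> ?C x"
    proof
      fix z assume z: "z \<in> U \<inter> affine hull ?C x"
      have "a j \<bullet> z = b j" if "j \<in> J" "a j \<bullet> x = b j" for j
      proof -
        have "affine hull ?C x \<subseteq> {z. a j \<bullet> z = b j}"
          by (rule hull_minimal)
            (use that in \<open>auto simp: arrangement_cell_def affine_hyperplane intro: antisym\<close>)
        then show ?thesis using z by blast
      qed
      then show "z \<in> ?C x"
        using z unfolding U_def arrangement_cell_def by (auto simp: order_le_less)
    qed
    ultimately show "y \<in> rel_interior (?C x)"
      using y unfolding mem_rel_interior by blast
  qed
  then show ?thesis
    unfolding rel_frontier_def using closed_arrangement_cell[of J a b x] by auto
qed

text \<open>The selection is extended one cell at a time, from the relative frontier to the whole cell; the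
  set of cells treated so far is kept closed under passing to faces.\<close>

lemma cellwise_selection:
  fixes T :: "'a::euclidean_space \<Rightarrow> 'b::topological_space set"
  assumes J: "finite J" and B: "compact B" "aff_dim B \<le> int n"
    and cells: "\<And>x. x \<in> B \<Longrightarrow> arrangement_cell J a b x \<subseteq> B"
    and conn: "\<And>x. x \<in> B \<Longrightarrow> n_connected_space (int n - 1) (top_of_set (T x))"
    and mono: "\<And>x y. x \<in> B \<Longrightarrow> y \<in> arrangement_cell J a b x \<Longrightarrow> T y \<subseteq> T x"
  obtains f where "continuous_on B f" "\<And>x. x \<in> B \<Longrightarrow> f x \<in> T x"
proof -
  let ?C = "arrangement_cell J a b"
  have sel: "\<exists>f. continuous_on (\<Union>\<S>) f \<and> (\<forall>x\<in>\<Union>\<S>. f x \<in> T x)"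
    if "finite \<S>" "\<S> \<subseteq> ?C ` B" "\<And>c y. c \<in> \<S> \<Longrightarrow> y \<in> c \<Longrightarrow> ?C y \<in> \<S>" for \<S>
    using that
  proof (induction "card \<S>" arbitrary: \<S>)
    case 0
    then show ?case by auto
  next
    case (Suc k)
    \<comment> \<open>An inclusion-maximal cell is not a proper face of another one, so the
      remaining family is still closed under faces and meets \<open>c\<close> only in its relative
      frontier.\<close>
    obtain c where c: "c \<in> \<S>" and cmax: "\<And>c'. c' \<in> \<S> \<Longrightarrow> c \<subseteq> c' \<Longrightarrow> c' = c"
      using finite_has_maximal[of \<S>] Suc.prems(1) Suc.hyps(2) by (metis card.empty nat.distinct(1))
    obtain x where x: "x \<in> B" "c = ?C x" using c Suc.prems(2) by blast
    let ?S = "\<S> - {c}"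
    have "\<exists>f. continuous_on (\<Union>?S) f \<and> (\<forall>x\<in>\<Union>?S. f x \<in> T x)"
    proof (rule Suc.hyps(1))
      show "?C y \<in> ?S" if "c' \<in> ?S" "y \<in> c'" for c' y
      proof -
        have "?C y \<subseteq> c'" using that Suc.prems(2) arrangement_cell_mono by blast
        then show ?thesis using that cmax[of c'] Suc.prems(3)[of c' y] by auto
      qed
    qed (use Suc.prems Suc.hyps(2) c in auto)
    then obtain f where f: "continuous_on (\<Union>?S) f" "\<And>x. x \<in> \<Union>?S \<Longrightarrow> f x \<in> T x" by blast
    have inter: "rel_frontier c = c \<inter> \<Union>?S"
    proof -
      have "y \<in> \<Union>?S" if "y \<in> c" "x \<notin> ?C y" for y
        using Suc.prems(3)[OF c that(1)] that(2) x(2) arrangement_cell_refl by blast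
      moreover have False if y: "y \<in> c" "x \<in> ?C y" and c': "y \<in> c'" "c' \<in> ?S" for y c'
      proof -
        have "?C y \<subseteq> c'" using c' Suc.prems(2) arrangement_cell_mono by blast
        moreover have "c \<subseteq> ?C y" using x(2) y(2) arrangement_cell_mono by blast
        ultimately show False using cmax[of c'] c' by blast
      qed
      ultimately show ?thesis
        unfolding x(2) rel_frontier_arrangement_cell[OF J] by blast
    qed
    have cc: "convex c" "closed c" unfolding x(2) by (rule convex_arrangement_cell closed_arrangement_cell)+
    have cB: "c \<subseteq> B" using cells x by blast
    have "compact c" using \<open>closed c\<close> cB \<open>compact B\<close> by (metis compact_Int_closed inf.absorb2)
    have "aff_dim c \<le> int n" using aff_dim_subset[OF cB] B(2) by linarith
    have "continuous_map (top_of_set (rel_frontier c)) (top_of_set (T x)) f"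
    proof -
      have "f y \<in> T x" if "y \<in> rel_frontier c" for y
        using f(2)[of y] mono[OF x(1), of y] that x(2) unfolding inter by blast
      moreover have "continuous_on (rel_frontier c) f"
        using f(1) inter continuous_on_subset by fastforce
      ultimately show ?thesis by auto
    qed
    then obtain g where g: "continuous_map (top_of_set c) (top_of_set (T x)) g"
      "\<And>y. y \<in> rel_frontier c \<Longrightarrow> g y = f y"
      using n_connected_extend_cell[OF conn[OF x(1)] cc(1) \<open>compact c\<close> \<open>aff_dim c \<le> int n\<close>] by metis
    define h where "h = (\<lambda>y. if y \<in> c then g y else f y)"
    have "continuous_on (c \<union> \<Union>?S) h"
      unfolding h_def
    proof (rule continuous_on_cases)
      show "closed (\<Union>?S)"
        using Suc.prems(1,2) by (intro closed_Union ballI) (auto simp: closed_arrangement_cell)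
    qed (use g f(1) inter \<open>closed c\<close> in auto)
    moreover have "c \<union> \<Union>?S = \<Union>\<S>" using c by blast
    \<comment> \<open>\<open>T\<close> is constant on the relative interior of \<open>c\<close>:
      there \<open>x\<close> and \<open>y\<close> lie in each other's cells, so values in
      \<open>T x\<close> are also in \<open>T y\<close>.\<close>
    moreover have "h y \<in> T y" if "y \<in> \<Union>\<S>" for y
    proof (cases "y \<in> c \<and> y \<notin> rel_frontier c")
      case True
      then have y: "x \<in> ?C y" unfolding x(2) rel_frontier_arrangement_cell[OF J] by blast
      have "g y \<in> T x" using g(1) True by auto
      moreover have "T x \<subseteq> T y" using mono[OF _ y] True cB by blast
      ultimately show ?thesis using True by (auto simp: h_def)
    next
      case False
      then have "y \<in> \<Union>?S" using that inter by blast
      moreover have "h y = f y" using False g(2) by (auto simp: h_def)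
      ultimately show ?thesis using f(2) by simp
    qed
    ultimately show ?case by auto
  qed
  have "\<exists>f. continuous_on (\<Union>(?C ` B)) f \<and> (\<forall>x\<in>\<Union>(?C ` B). f x \<in> T x)"
  proof (rule sel)
    show "?C y \<in> ?C ` B" if "c \<in> ?C ` B" "y \<in> c" for c y
      using that cells by blast
  qed (use finite_arrangement_cells[OF J] in auto)
  moreover have "\<Union>(?C ` B) = B"
    using cells arrangement_cell_refl[of _ J a b] by fast
  ultimately obtain f where "continuous_on B f" "\<forall>x\<in>B. f x \<in> T x" by auto
  then show ?thesis using that by blast
qed

section \<open>Common points of polytopes\<close>

text \<open>Numbering the half-spaces by naturals fits the families of sets of naturals in the
  definition of admissibility.\<close>

lemma polyhedra_common_halfspaces:
  fixes \<P> :: "'a::euclidean_space set set"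
  assumes "finite \<P>" "\<And>P. P \<in> \<P> \<Longrightarrow> polyhedron P"
  obtains a :: "nat \<Rightarrow> 'a" and b J where
    "\<And>P. P \<in> \<P> \<Longrightarrow> finite (J P)" "\<And>P. P \<in> \<P> \<Longrightarrow> P = {y. \<forall>j\<in>J P. a j \<bullet> y \<le> b j}"
proof -
  have "\<exists>H. finite H \<and> P = {y. \<forall>h\<in>H. fst h \<bullet> y \<le> snd h}" if P: "P \<in> \<P>" for P
  proof -
    obtain \<F> where \<F>: "finite \<F>" "P = \<Inter>\<F>" "\<forall>h\<in>\<F>. \<exists>a b. a \<noteq> 0 \<and> h = {x. a \<bullet> x \<le> b}"
      using assms(2)[OF P] unfolding polyhedron_def by blast
    then obtain a b where ab: "\<And>h. h \<in> \<F> \<Longrightarrow> h = {x. a h \<bullet> x \<le> b h}" by metis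
    have "P = {y. \<forall>h\<in>(\<lambda>h. (a h, b h)) ` \<F>. fst h \<bullet> y \<le> snd h}"
      unfolding \<F>(2) using ab by auto
    then show ?thesis using \<F>(1) by blast
  qed
  then have "\<exists>H. \<forall>P\<in>\<P>. finite (H P) \<and> P = {y. \<forall>h\<in>H P. fst h \<bullet> y \<le> snd h}"
    by (intro bchoice ballI)
  then obtain H where H: "\<forall>P\<in>\<P>. finite (H P) \<and> P = {y. \<forall>h\<in>H P. fst h \<bullet> y \<le> snd h}"
    by (rule exE)
  have "finite (\<Union>P\<in>\<P>. H P)"
    using assms(1) H by auto
  from finite_list[OF this] obtain hs where hs: "set hs = (\<Union>P\<in>\<P>. H P)"
    by (rule exE)
  show ?thesis
  proof (rule that[of "\<lambda>P. {j. j < length hs \<and> hs ! j \<in> H P}" "\<lambda>j. fst (hs ! j)" "\<lambda>j. snd (hs ! j)"])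
    fix P assume P: "P \<in> \<P>"
    have "\<exists>j<length hs. hs ! j = h" if "h \<in> H P" for h
      using that P hs in_set_conv_nth[of h hs] by auto
    then have "{y. \<forall>h\<in>H P. fst h \<bullet> y \<le> snd h} =
        {y. \<forall>j\<in>{j. j < length hs \<and> hs ! j \<in> H P}. fst (hs ! j) \<bullet> y \<le> snd (hs ! j)}"
      by fastforce
    then show "P = {y. \<forall>j\<in>{j. j < length hs \<and> hs ! j \<in> H P}. fst (hs ! j) \<bullet> y \<le> snd (hs ! j)}"
      using bspec[OF H P] by simp
  qed auto
qed

text \<open>Turns the realization into a set in a function type, so that it can serve as a value
  \<open>T x\<close> in the cellwise selection.\<close>

lemma realization_eq_top_of_set: "realization K = top_of_set (topspace (realization K))"
  unfolding realization_def by (simp add: euclidean_product_topology)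

lemma topspace_realization_mono: "K \<subseteq> K' \<Longrightarrow> topspace (realization K) \<subseteq> topspace (realization K')"
  unfolding realization_def by auto

lemma selection_complex_mono:
  assumes "simplicial_complex_on W K" "U \<subseteq> U'" "\<And>w. w \<in> U \<Longrightarrow> D w \<subseteq> D' w"
  shows "selection_complex K U D \<subseteq> selection_complex K U' D'"
proof
  fix \<phi> assume "\<phi> \<in> selection_complex K U D"
  then obtain \<sigma> \<rho> where \<sigma>: "\<sigma> \<in> K" and \<phi>: "\<phi> = Sigma (\<sigma> \<inter> U) \<rho>"
    and \<rho>: "\<And>w. w \<in> \<sigma> \<inter> U \<Longrightarrow> \<rho> w \<in> discrete_complex (D w)"
    by (auto simp: selection_complex_def restrict_complex_def iterated_join_def)
  have "\<sigma> \<inter> U \<in> K" using \<sigma> assms(1) by (auto simp: simplicial_complex_on_def)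
  moreover have "\<sigma> \<inter> U = (\<sigma> \<inter> U) \<inter> U'" using assms(2) by blast
  ultimately have "\<sigma> \<inter> U \<in> restrict_complex K U'" unfolding restrict_complex_def by blast
  moreover have "\<rho> w \<in> discrete_complex (D' w)" if "w \<in> \<sigma> \<inter> U" for w
    using \<rho>[OF that] assms(3)[of w] that by (auto simp: discrete_complex_def)
  ultimately show "\<phi> \<in> selection_complex K U' D'"
    unfolding selection_complex_def iterated_join_def \<phi> by blast
qed

text \<open>The case of points, one \<open>q \<sigma>\<close> for each face. The dimension bound
  concerns the points and not the ambient space, so that it applies inside a translate of a
  subspace.\<close>

proposition admissible_common_point:
  fixes q :: "'w set \<Rightarrow> 'a::euclidean_space"
  assumes "finite W" and adm: "admissible_selection_structure n W K \<L>"
    and dim: "aff_dim (q ` K) \<le> int n"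
  shows "\<exists>x. {w \<in> W. x \<notin> convex hull (q ` {\<sigma> \<in> K. w \<in> \<sigma>})} \<notin> \<L>"
proof (rule ccontr)
  define G where "G = (\<lambda>w. convex hull (q ` {\<sigma> \<in> K. w \<in> \<sigma>}))"
  define U where "U = (\<lambda>x. {w \<in> W. x \<notin> G w})"
  assume "\<not> ?thesis"
  then have UL: "U x \<in> \<L>" for x unfolding U_def G_def by blast
  have K: "simplicial_complex_on W K"
    and conn: "\<And>D U. (\<forall>w\<in>W. finite (D w) \<and> D w \<noteq> {}) \<Longrightarrow> U \<in> \<L> \<Longrightarrow>
      n_connected_complex (int n - 1) (selection_complex K U (D :: 'w \<Rightarrow> nat set))"
    using adm by (simp_all add: admissible_selection_structure_def)
  have "finite K"
    using K \<open>finite W\<close> by (auto simp: simplicial_complex_on_def intro: finite_subset[of K "Pow W"])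
  define B where "B = convex hull (q ` K)"
  have polyB: "polytope B" and polyG: "polytope (G w)" for w
    using \<open>finite K\<close> unfolding B_def G_def by (auto intro!: polytope_convex_hull)
  obtain a :: "nat \<Rightarrow> 'a" and b J where
    J: "\<And>P. P \<in> insert B (G ` W) \<Longrightarrow> finite (J P)"
      "\<And>P. P \<in> insert B (G ` W) \<Longrightarrow> P = {y. \<forall>j\<in>J P. a j \<bullet> y \<le> b j}"
  proof (rule polyhedra_common_halfspaces[of "insert B (G ` W)"])
    show "polyhedron P" if "P \<in> insert B (G ` W)" for P
      using that polyB polyG polytope_imp_polyhedron by blast
  qed (use \<open>finite W\<close> in auto)
  have Bmem: "y \<in> B \<longleftrightarrow> (\<forall>j\<in>J B. a j \<bullet> y \<le> b j)" for y
    using J(2)[of B] by blast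
  have Gmem: "y \<in> G w \<longleftrightarrow> (\<forall>j\<in>J (G w). a j \<bullet> y \<le> b j)" if "w \<in> W" for y w
    using J(2)[of "G w"] that by blast
  define Z where "Z = (\<lambda>x w. {j \<in> J (G w). b j < a j \<bullet> x})"
  \<comment> \<open>The value \<open>{0}\<close> is a placeholder where no half-space excludes
    \<open>x\<close>: admissibility asks for non-empty sets at every index, while the complex over
    \<open>U x\<close> only sees indices with \<open>Z x w\<close> non-empty.\<close>
  define D where "D = (\<lambda>x w. if Z x w = {} then {0} else Z x w)"
  have DU: "D x w = Z x w" if "w \<in> U x" for x w
    using that Gmem[of w x] by (auto simp: U_def D_def Z_def not_le)
  define C where "C = (\<lambda>x. selection_complex K (U x) (D x))"
  define T where "T = (\<lambda>x. topspace (realization (C x)))"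
  \<comment> \<open>The half-spaces of \<open>B\<close> are included so that the cell of a point of
    \<open>B\<close> stays in \<open>B\<close>.\<close>
  define JJ where "JJ = J B \<union> (\<Union>w\<in>W. J (G w))"
  have "finite JJ" unfolding JJ_def using J(1) \<open>finite W\<close> by auto
  have "compact B" "convex B" "closed B"
    using polyB by (simp_all add: polytope_imp_compact polytope_imp_convex polytope_imp_closed)
  obtain f where f: "continuous_on B f" "\<And>x. x \<in> B \<Longrightarrow> f x \<in> T x"
  proof (rule cellwise_selection[of JJ B n a b T])
    show "aff_dim B \<le> int n" unfolding B_def using dim by (simp add: aff_dim_convex_hull)
    show "arrangement_cell JJ a b x \<subseteq> B" if "x \<in> B" for x
      using that Bmem by (auto simp: arrangement_cell_def JJ_def)
    show "n_connected_space (int n - 1) (top_of_set (T x))" for x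
    proof -
      have "\<forall>w\<in>W. finite (D x w) \<and> D x w \<noteq> {}"
        using J(1) by (auto simp: D_def Z_def)
      then have "n_connected_space (int n - 1) (realization (C x))"
        using conn UL unfolding n_connected_complex_def C_def by blast
      then show ?thesis unfolding T_def by (subst (asm) realization_eq_top_of_set)
    qed
    show "T y \<subseteq> T x" if y: "y \<in> arrangement_cell JJ a b x" for x y
    proof -
      \<comment> \<open>For \<open>y\<close> in the cell of \<open>x\<close>, a half-space excluding
        \<open>y\<close> already excludes \<open>x\<close>.\<close>
      have Zsub: "Z y w \<subseteq> Z x w" if "w \<in> W" for w
        using y that unfolding Z_def arrangement_cell_def JJ_def
        by (auto simp: not_le[symmetric])
      have Zne: "w \<in> U x \<longleftrightarrow> w \<in> W \<and> Z x w \<noteq> {}" for x w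
        using Gmem[of w x] by (simp add: U_def Z_def) (meson not_le)
      have Usub: "U y \<subseteq> U x"
      proof
        fix w assume "w \<in> U y"
        then show "w \<in> U x" using Zne[of w x] Zne[of w y] Zsub[of w] by auto
      qed
      have "D y w \<subseteq> D x w" if w: "w \<in> U y" for w
      proof -
        have "w \<in> U x" "w \<in> W" using w Usub by (auto simp: U_def)
        then show ?thesis using Zsub DU w by simp
      qed
      then show ?thesis
        unfolding T_def C_def by (intro topspace_realization_mono selection_complex_mono[OF K Usub])
    qed
  qed (use \<open>finite JJ\<close> \<open>compact B\<close> in auto)
  \<comment> \<open>The vectors \<open>- a j\<close> are the inner normals. The fixed index set
    \<open>W \<times> JJ\<close>, which contains the support of \<open>f x\<close>, makes continuity
    of \<open>v\<close> immediate.\<close>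
  define v where "v = (\<lambda>x. \<Sum>p\<in>W \<times> JJ. f x p *\<^sub>R (- a (snd p)))"
  have supp: "\<exists>\<sigma>\<in>K. 0 < v x \<bullet> (q \<sigma> - x)" if x: "x \<in> B" for x
  proof -
    have f0: "f x p \<ge> 0" and fC: "{p. f x p \<noteq> 0} \<in> C x" and f1: "(\<Sum>p | f x p \<noteq> 0. f x p) = 1" for p
      using f(2)[OF x] unfolding T_def realization_def by (cases p; simp)+
    obtain \<sigma> \<rho> where \<sigma>: "\<sigma> \<in> K" and S: "{p. f x p \<noteq> 0} = Sigma (\<sigma> \<inter> U x) \<rho>"
      and \<rho>: "\<And>w. w \<in> \<sigma> \<inter> U x \<Longrightarrow> \<rho> w \<in> discrete_complex (D x w)"
      using fC by (auto simp: C_def selection_complex_def restrict_complex_def iterated_join_def)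
    \<comment> \<open>\<open>q \<sigma>\<close> lies in \<open>G w\<close> for all
      \<open>w \<in> \<sigma>\<close>, so it satisfies every inequality in the support of
      \<open>f x\<close>, while \<open>x\<close> violates them all.\<close>
    have term_pos: "p \<in> W \<times> JJ \<and> 0 < a (snd p) \<bullet> (x - q \<sigma>)" if p: "f x p \<noteq> 0" for p
    proof -
      obtain w j where [simp]: "p = (w, j)" by (cases p)
      have w: "w \<in> \<sigma>" "w \<in> U x" and "j \<in> \<rho> w" using p S by auto
      then have "j \<in> Z x w" using \<rho>[of w] DU[of w x] by (auto simp: discrete_complex_def)
      then have j: "j \<in> J (G w)" "b j < a j \<bullet> x" by (auto simp: Z_def)
      have "w \<in> W" using w(2) by (simp add: U_def)
      have "q \<sigma> \<in> G w" unfolding G_def using \<sigma> w(1) by (intro hull_inc) auto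
      then have "a j \<bullet> q \<sigma> \<le> b j" using Gmem[OF \<open>w \<in> W\<close>] j(1) by blast
      then show ?thesis using j \<open>w \<in> W\<close> by (auto simp: JJ_def inner_diff_right)
    qed
    have "{p. f x p \<noteq> 0} \<noteq> {}"
      using f1 by (metis sum.empty zero_neq_one)
    then obtain p where p: "f x p \<noteq> 0" by blast
    have "v x \<bullet> (q \<sigma> - x) = (\<Sum>p\<in>W \<times> JJ. f x p * (a (snd p) \<bullet> (x - q \<sigma>)))"
      unfolding v_def inner_sum_left by (rule sum.cong) (simp_all add: inner_diff_right algebra_simps)
    also have "0 < \<dots>"
    proof (rule sum_pos2)
      show "finite (W \<times> JJ)" using \<open>finite W\<close> \<open>finite JJ\<close> by simp
      show "p \<in> W \<times> JJ" using term_pos p by blast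
      show "0 < f x p * (a (snd p) \<bullet> (x - q \<sigma>))" using term_pos[OF p] f0[of p] p by simp
      show "0 \<le> f x r * (a (snd r) \<bullet> (x - q \<sigma>))" for r
        using term_pos[of r] f0[of r] by (cases "f x r = 0") auto
    qed
    finally show ?thesis using \<sigma> by blast
  qed
  have "K \<noteq> {}"
  proof
    assume "K = {}"
    then have "topspace (realization (selection_complex K (U 0) (\<lambda>_. {0 :: nat}))) = {}"
      by (simp add: selection_complex_def restrict_complex_def realization_def)
    moreover have "n_connected_complex (int n - 1) (selection_complex K (U 0) (\<lambda>_. {0 :: nat}))"
      using conn[of "\<lambda>_. {0}" "U 0"] UL by simp
    ultimately show False
      by (simp add: n_connected_complex_def n_connected_space_def)
  qed
  then have "B \<noteq> {}" unfolding B_def by simp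
  have contv: "continuous_on B v"
    unfolding v_def by (intro continuous_intros continuous_on_product_then_coordinatewise[OF f(1)])
  \<comment> \<open>If \<open>x\<close> is the projection of \<open>x + v x\<close> to
    \<open>B\<close>, then \<open>v x\<close> is an outer normal of \<open>B\<close> at
    \<open>x\<close> and has non-positive inner product with \<open>q \<sigma> - x\<close> for every
    face, contrary to \<open>supp\<close>.\<close>
  obtain x where x: "x \<in> B" "closest_point B (x + v x) = x"
  proof (rule brouwer[OF \<open>compact B\<close> \<open>convex B\<close> \<open>B \<noteq> {}\<close>])
    have "continuous_on ((\<lambda>x. x + v x) ` B) (closest_point B)"
      using continuous_on_closest_point[OF \<open>convex B\<close> \<open>closed B\<close> \<open>B \<noteq> {}\<close>] .
    then show "continuous_on B (\<lambda>x. closest_point B (x + v x))"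
      by (rule continuous_on_compose2) (use contv in \<open>auto intro!: continuous_intros\<close>)
    show "(\<lambda>x. closest_point B (x + v x)) \<in> B \<rightarrow> B"
      using closest_point_in_set[OF \<open>closed B\<close> \<open>B \<noteq> {}\<close>] by auto
  qed
  obtain \<sigma> where \<sigma>: "\<sigma> \<in> K" "0 < v x \<bullet> (q \<sigma> - x)" using supp[OF x(1)] by blast
  have "q \<sigma> \<in> B" unfolding B_def using \<sigma>(1) by (intro hull_inc) auto
  then show False
    using closest_point_dot[OF \<open>convex B\<close> \<open>closed B\<close>, of "q \<sigma>" "x + v x"] \<sigma>(2) x(2) by simp
qed

section \<open>Transversal subspaces and lineality directions\<close>

text \<open>If the vector \<open>u\<close> found so far lies in the new \<open>V\<close>, take a
  line \<open>w + c *\<^sub>R u\<close> with \<open>w \<in> E\<close> outside \<open>V\<close>. It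
  misses \<open>V\<close> and meets each earlier subspace at most once, because \<open>u\<close> is
  not in it, so some \<open>c\<close> works.\<close>

lemma exists_vector_avoiding_subspaces:
  fixes E :: "'a::real_vector set"
  assumes "subspace E" "finite \<V>" "\<And>V. V \<in> \<V> \<Longrightarrow> subspace V \<and> \<not> E \<subseteq> V"
  shows "\<exists>u\<in>E. \<forall>V\<in>\<V>. u \<notin> V"
  using assms(2,3)
proof (induction \<V>)
  case empty
  then show ?case using subspace_0[OF assms(1)] by blast
next
  case (insert V \<V>)
  obtain u where u: "u \<in> E" "\<forall>V\<in>\<V>. u \<notin> V" using insert by blast
  show ?case
  proof (cases "u \<in> V")
    case False
    then show ?thesis using u by blast
  next
    case True
    have V: "subspace V" "\<not> E \<subseteq> V" using insert.prems by auto
    then obtain w where w: "w \<in> E" "w \<notin> V" by blast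
    define bad where "bad = (\<lambda>V'. {c. w + c *\<^sub>R u \<in> V'})"
    have "finite (bad V')" if V': "V' \<in> \<V>" for V'
    proof -
      have sub: "subspace V'" "u \<notin> V'" using insert.prems V' u(2) by auto
      have "c = c'" if "w + c *\<^sub>R u \<in> V'" "w + c' *\<^sub>R u \<in> V'" for c c'
      proof (rule ccontr)
        assume "c \<noteq> c'"
        have "(c - c') *\<^sub>R u \<in> V'"
          using subspace_diff[OF sub(1) that] by (simp add: algebra_simps)
        then have "(1 / (c - c')) *\<^sub>R (c - c') *\<^sub>R u \<in> V'"
          by (rule subspace_scale[OF sub(1)])
        then show False using \<open>c \<noteq> c'\<close> sub(2) by simp
      qed
      then have "bad V' \<subseteq> {SOME c. c \<in> bad V'}"
        unfolding bad_def by (auto intro: someI2)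
      then show ?thesis by (rule finite_subset) simp
    qed
    then have "finite (\<Union>V'\<in>\<V>. bad V')" using insert.hyps by blast
    then obtain c where c: "c \<notin> (\<Union>V'\<in>\<V>. bad V')"
      using ex_new_if_finite[OF infinite_UNIV_char_0] by blast
    have "w + c *\<^sub>R u \<notin> V"
    proof
      assume "w + c *\<^sub>R u \<in> V"
      then have "(w + c *\<^sub>R u) - c *\<^sub>R u \<in> V"
        by (rule subspace_diff[OF V(1) _ subspace_scale[OF V(1) True]])
      then show False using w(2) by simp
    qed
    moreover have "w + c *\<^sub>R u \<in> E"
      using w(1) u(1) assms(1) by (simp add: subspace_add subspace_scale)
    ultimately show ?thesis using c unfolding bad_def by blast
  qed
qed

text \<open>Induction on the codimension \<open>m\<close>: a vector \<open>u\<close> outside all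
  \<open>L\<close> is added to each of them, which lowers the codimension, and then to the
  complement of the enlarged subspaces. The last conjunct says that \<open>N\<close> and
  \<open>L\<close> together span \<open>E\<close>.\<close>

lemma exists_common_complement:
  fixes E :: "'a::euclidean_space set"
  assumes "subspace E" "finite \<LL>" "\<And>L. L \<in> \<LL> \<Longrightarrow> subspace L \<and> L \<subseteq> E \<and> dim L = k"
    and "dim E = k + m"
  shows "\<exists>N. subspace N \<and> N \<subseteq> E \<and> dim N \<le> m \<and> (\<forall>L\<in>\<LL>. \<forall>y\<in>E. \<exists>n\<in>N. y - n \<in> L)"
  using assms(2-)
proof (induction m arbitrary: k \<LL>)
  case 0
  have "L = E" if "L \<in> \<LL>" for L
    using 0 that assms(1) by (intro subspace_dim_equal) auto
  then show ?case
    using subspace_0[OF assms(1)] by (intro exI[of _ "{0}"]) auto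
next
  case (Suc m)
  have "\<not> E \<subseteq> L" if "L \<in> \<LL>" for L
  proof
    assume "E \<subseteq> L"
    then have "dim E \<le> dim L" by (rule dim_subset)
    then show False using Suc.prems that by auto
  qed
  then obtain u where u: "u \<in> E" "\<forall>L\<in>\<LL>. u \<notin> L"
    using exists_vector_avoiding_subspaces[OF assms(1) Suc.prems(1)] Suc.prems(2) by blast
  let ?\<LL>' = "(\<lambda>L. span (insert u L)) ` \<LL>"
  have "\<exists>N. subspace N \<and> N \<subseteq> E \<and> dim N \<le> m \<and> (\<forall>L\<in>?\<LL>'. \<forall>y\<in>E. \<exists>n\<in>N. y - n \<in> L)"
  proof (rule Suc.IH)
    fix L' assume "L' \<in> ?\<LL>'"
    then obtain L where L: "L \<in> \<LL>" and L': "L' = span (insert u L)" by blast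
    have "subspace L" "L \<subseteq> E" "dim L = k" using Suc.prems(2)[OF L] by auto
    then have "dim L' = Suc k"
      using u(2) L unfolding L' dim_span by (simp add: dim_insert span_eq_iff[THEN iffD2])
    moreover have "L' \<subseteq> E"
      unfolding L' using \<open>L \<subseteq> E\<close> u(1) assms(1) by (intro span_minimal) auto
    ultimately show "subspace L' \<and> L' \<subseteq> E \<and> dim L' = Suc k" unfolding L' by simp
  qed (use Suc.prems in auto)
  then obtain N where N: "subspace N" "N \<subseteq> E" "dim N \<le> m"
    and Ncomp: "\<And>L y. L \<in> \<LL> \<Longrightarrow> y \<in> E \<Longrightarrow> \<exists>n\<in>N. y - n \<in> span (insert u L)"
    by auto
  show ?case
  proof (intro exI[of _ "span (insert u N)"] conjI ballI)
    show "span (insert u N) \<subseteq> E" using N(2) u(1) assms(1) by (intro span_minimal) auto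
    show "dim (span (insert u N)) \<le> Suc m" unfolding dim_span using N(3) by (simp add: dim_insert)
    fix L y assume L: "L \<in> \<LL>" and "y \<in> E"
    then obtain n where n: "n \<in> N" "y - n \<in> span (insert u L)" using Ncomp by blast
    then obtain c where "(y - n) - c *\<^sub>R u \<in> span L" unfolding span_breakdown_eq by blast
    moreover have "span L = L" using Suc.prems(2)[OF L] by (simp add: span_eq_iff)
    ultimately have "y - (n + c *\<^sub>R u) \<in> L" by (simp add: algebra_simps)
    moreover have "n + c *\<^sub>R u \<in> span (insert u N)"
      using n(1) by (intro span_add span_scale) (auto intro: span_base)
    ultimately show "\<exists>n\<in>span (insert u N). y - n \<in> L" by blast
  qed simp
qed

text \<open>The normal \<open>a\<close> is a linear combination of normals of the individual subspaces, which gives the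
  bound without a compactness argument.\<close>

lemma bounded_on_common_neighbourhood:
  fixes \<V> :: "'a::euclidean_space set set"
  assumes sub: "\<And>V. V \<in> \<V> \<Longrightarrow> subspace V" and a: "a \<in> (\<Inter>\<V>)\<^sup>\<bottom>"
  shows "\<exists>C. \<forall>x. (\<forall>V\<in>\<V>. \<exists>r. norm r \<le> R \<and> x - r \<in> V) \<longrightarrow> \<bar>a \<bullet> x\<bar> \<le> C"
proof -
  define X where "X = {x. \<forall>V\<in>\<V>. \<exists>r. norm r \<le> R \<and> x - r \<in> V}"
  let ?S = "span (\<Union>V\<in>\<V>. V\<^sup>\<bottom>)"
  have "?S\<^sup>\<bottom> \<subseteq> V" if "V \<in> \<V>" for V
  proof -
    have "V\<^sup>\<bottom> \<subseteq> ?S" by (rule order_trans[OF _ span_superset]) (use that in blast)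
    then have "?S\<^sup>\<bottom> \<subseteq> V\<^sup>\<bottom>\<^sup>\<bottom>" by (rule orthogonal_comp_anti_mono)
    then show ?thesis using orthogonal_comp_self[OF sub[OF that]] by simp
  qed
  then have "?S\<^sup>\<bottom> \<subseteq> \<Inter>\<V>" by blast
  then have "(\<Inter>\<V>)\<^sup>\<bottom> \<subseteq> ?S\<^sup>\<bottom>\<^sup>\<bottom>" by (rule orthogonal_comp_anti_mono)
  then have "a \<in> ?S" using a orthogonal_comp_self[of ?S] by auto
  then have "\<exists>C. \<forall>x\<in>X. \<bar>a \<bullet> x\<bar> \<le> C"
  proof (induction rule: span_induct)
    case base
    show ?case
    proof (rule subspaceI; unfold mem_Collect_eq)
      show "\<exists>C. \<forall>x\<in>X. \<bar>0 \<bullet> x\<bar> \<le> C" by auto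
    next
      fix a a' assume "\<exists>C. \<forall>x\<in>X. \<bar>a \<bullet> x\<bar> \<le> C" "\<exists>C. \<forall>x\<in>X. \<bar>a' \<bullet> x\<bar> \<le> C"
      then obtain C C' where C: "\<And>x. x \<in> X \<Longrightarrow> \<bar>a \<bullet> x\<bar> \<le> C" "\<And>x. x \<in> X \<Longrightarrow> \<bar>a' \<bullet> x\<bar> \<le> C'"
        by blast
      have "\<bar>(a + a') \<bullet> x\<bar> \<le> C + C'" if "x \<in> X" for x
        using C[OF that] unfolding inner_add_left by linarith
      then show "\<exists>C. \<forall>x\<in>X. \<bar>(a + a') \<bullet> x\<bar> \<le> C" by blast
    next
      fix c a assume "\<exists>C. \<forall>x\<in>X. \<bar>a \<bullet> x\<bar> \<le> C"
      then obtain C where C: "\<And>x. x \<in> X \<Longrightarrow> \<bar>a \<bullet> x\<bar> \<le> C" by blast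
      have "\<bar>(c *\<^sub>R a) \<bullet> x\<bar> \<le> \<bar>c\<bar> * C" if "x \<in> X" for x
        using C[OF that] by (simp add: abs_mult mult_left_mono)
      then show "\<exists>C. \<forall>x\<in>X. \<bar>(c *\<^sub>R a) \<bullet> x\<bar> \<le> C" by blast
    qed
  next
    case (step a)
    then obtain V where V: "V \<in> \<V>" "a \<in> V\<^sup>\<bottom>" by blast
    have "\<bar>a \<bullet> x\<bar> \<le> norm a * R" if x: "x \<in> X" for x
    proof -
      obtain r where r: "norm r \<le> R" "x - r \<in> V" using x V(1) unfolding X_def by blast
      have "(x - r) \<bullet> a = 0" using V(2) r(2) by (auto simp: orthogonal_comp_def orthogonal_def)
      then have "a \<bullet> x = a \<bullet> r" by (simp add: inner_commute[of _ a] inner_diff_right)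
      then have "\<bar>a \<bullet> x\<bar> \<le> norm a * norm r" using Cauchy_Schwarz_ineq2[of a r] by simp
      also have "\<dots> \<le> norm a * R" using r(1) by (simp add: mult_left_mono)
      finally show ?thesis .
    qed
    then show ?case by blast
  qed
  then show ?thesis unfolding X_def by simp
qed

text \<open>A line in \<open>C\<close> makes its direction a recession direction: convex
  combinations of \<open>y\<close> with ever farther points of the line, weighted inversely to the
  distance, tend to \<open>y + l\<close>.\<close>

lemma closed_convex_translation_invariant:
  fixes C :: "'a::real_normed_vector set"
  assumes "closed C" "convex C" and p: "\<And>c. p + c *\<^sub>R l \<in> C" and y: "y \<in> C"
  shows "y + l \<in> C"
proof -
  define s where "s = (\<lambda>n. (1 - inverse (real (Suc n))) *\<^sub>R y + inverse (real (Suc n)) *\<^sub>R (p + real (Suc n) *\<^sub>R l))"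
  have "s n \<in> C" for n
    unfolding s_def by (rule convexD_alt[OF \<open>convex C\<close> y p]) (auto simp: field_simps)
  moreover have "s = (\<lambda>n. y + l + inverse (real (Suc n)) *\<^sub>R (p - y))"
    unfolding s_def by (auto simp: algebra_simps simp del: of_nat_Suc)
  moreover have "(\<lambda>n. y + l + inverse (real (Suc n)) *\<^sub>R (p - y)) \<longlonglongrightarrow> y + l + 0 *\<^sub>R (p - y)"
    by (intro tendsto_intros LIMSEQ_inverse_real_of_nat)
  ultimately show ?thesis
    using closed_sequentially[OF \<open>closed C\<close>, of s "y + l"] by simp
qed

text \<open>The induction uses the stronger claim for all multiples of \<open>v\<close> and all
  \<open>y\<close>, because the vectors with this property form a subspace.\<close>

lemma span_translation_invariant:
  assumes "\<And>l y. l \<in> L \<Longrightarrow> y \<in> C \<Longrightarrow> y + l \<in> C" and "\<And>c l. l \<in> L \<Longrightarrow> c *\<^sub>R l \<in> L"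
    and "v \<in> span L" "y \<in> C"
  shows "y + v \<in> (C :: 'a::real_vector set)"
proof -
  have "\<forall>y\<in>C. \<forall>c. y + c *\<^sub>R v \<in> C"
    using assms(3)
  proof (induction rule: span_induct)
    case base
    show ?case
    proof (rule subspaceI; unfold mem_Collect_eq)
      fix x x' assume "\<forall>y\<in>C. \<forall>c. y + c *\<^sub>R x \<in> C" "\<forall>y\<in>C. \<forall>c. y + c *\<^sub>R x' \<in> C"
      then show "\<forall>y\<in>C. \<forall>c. y + c *\<^sub>R (x + x') \<in> C"
        by (simp add: scaleR_add_right flip: add.assoc)
    qed auto
  next
    case (step l)
    then show ?case using assms(1,2) by blast
  qed
  from bspec[OF this assms(4)] have "y + 1 *\<^sub>R v \<in> C" by blast
  then show ?thesis by simp
qed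

section \<open>Flats in intersections\<close>

theorem theorem6:
  fixes W :: "'w set" and K \<L> :: "'w set set"
    and E :: "'a::euclidean_space set" and F :: "'w \<Rightarrow> 'a set"
    and k d :: nat
  assumes "finite W"
    and "subspace E" and "dim E = d"
    and "k \<le> d"
    and "admissible_selection_structure (d - k) W K \<L>"
    and "\<And>w. w \<in> W \<Longrightarrow> F w \<subseteq> E \<and> closed (F w) \<and> convex (F w)"
    and "\<And>\<sigma>. \<sigma> \<in> K \<Longrightarrow> contains_flat k (intersection_in E F \<sigma>)"
  shows "\<exists>W'\<subseteq>W. W - W' \<notin> \<L> \<and> contains_flat k (intersection_in E F W')"
proof -
  have K: "simplicial_complex_on W K"
    using assms(5) by (simp add: admissible_selection_structure_def)
  have "finite K"
    using K \<open>finite W\<close> by (auto simp: simplicial_complex_on_def intro: finite_subset[of K "Pow W"])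
  have KW: "w \<in> W" if "\<sigma> \<in> K" "w \<in> \<sigma>" for \<sigma> w
    using K that by (auto simp: simplicial_complex_on_def)

  \<comment> \<open>Base points and directions of the given flats\<close>
  have "\<exists>p L. subspace L \<and> dim L = k \<and> (\<forall>l\<in>L. p + l \<in> intersection_in E F \<sigma>)" if \<sigma>: "\<sigma> \<in> K" for \<sigma>
  proof -
    obtain A where A: "affine A" "aff_dim A = int k" "A \<subseteq> intersection_in E F \<sigma>"
      using assms(7)[OF \<sigma>] by (auto simp: contains_flat_def is_flat_def)
    then obtain p where p: "p \<in> A" by fastforce
    have "subspace ((\<lambda>x. x - p) ` A)" by (rule affine_diffs_subspace_subtract[OF A(1) p])
    moreover have "dim ((\<lambda>x. x - p) ` A) = k"
      using aff_dim_eq_dim_subtract[OF hull_inc[OF p]] A(2) by simp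
    moreover have "\<forall>l\<in>(\<lambda>x. x - p) ` A. p + l \<in> intersection_in E F \<sigma>" using A(3) by auto
    ultimately show ?thesis by blast
  qed
  then obtain p L where pL: "\<And>\<sigma>. \<sigma> \<in> K \<Longrightarrow> subspace (L \<sigma>)" "\<And>\<sigma>. \<sigma> \<in> K \<Longrightarrow> dim (L \<sigma>) = k"
    "\<And>\<sigma> l. \<sigma> \<in> K \<Longrightarrow> l \<in> L \<sigma> \<Longrightarrow> p \<sigma> + l \<in> intersection_in E F \<sigma>"
    by metis
  have pE: "p \<sigma> \<in> E" if "\<sigma> \<in> K" for \<sigma>
    using pL(3)[OF that subspace_0[OF pL(1)[OF that]]] by (simp add: intersection_in_def)
  have LE: "L \<sigma> \<subseteq> E" if "\<sigma> \<in> K" for \<sigma>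
  proof
    fix l assume "l \<in> L \<sigma>"
    then have "p \<sigma> + l \<in> E" using pL(3)[OF that] by (simp add: intersection_in_def)
    then show "l \<in> E" using subspace_diff[OF \<open>subspace E\<close> _ pE[OF that]] by fastforce
  qed

  \<comment> \<open>Translation directions of the sets \<open>F w\<close>\<close>
  define V where "V = (\<lambda>w. span (\<Union>\<sigma>\<in>{\<sigma>\<in>K. w \<in> \<sigma>}. L \<sigma>))"
  \<comment> \<open>Inserting \<open>E\<close> makes the intersection equal to \<open>E\<close> for
    empty \<open>W'\<close>.\<close>
  define VV where "VV = (\<lambda>W'. \<Inter>(insert E (V ` W')))"
  have subVV: "subspace (VV W')" for W'
    unfolding VV_def using \<open>subspace E\<close> by (intro subspace_Inter) (auto simp: V_def)
  have VF: "y + v \<in> F w" if w: "w \<in> W" and "v \<in> V w" "y \<in> F w" for y v w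
  proof (rule span_translation_invariant)
    show "v \<in> span (\<Union>\<sigma>\<in>{\<sigma>\<in>K. w \<in> \<sigma>}. L \<sigma>)" using \<open>v \<in> V w\<close> unfolding V_def .
    fix l assume "l \<in> (\<Union>\<sigma>\<in>{\<sigma>\<in>K. w \<in> \<sigma>}. L \<sigma>)"
    then obtain \<sigma> where \<sigma>: "\<sigma> \<in> K" "w \<in> \<sigma>" "l \<in> L \<sigma>" by blast
    have sc: "c *\<^sub>R l \<in> L \<sigma>" for c using pL(1)[OF \<sigma>(1)] \<sigma>(3) by (rule subspace_scale)
    then show "c *\<^sub>R l \<in> (\<Union>\<sigma>\<in>{\<sigma>\<in>K. w \<in> \<sigma>}. L \<sigma>)" for c using \<sigma> by blast
    have "p \<sigma> + c *\<^sub>R l \<in> F w" for c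
      using pL(3)[OF \<sigma>(1) sc] \<sigma>(2) by (auto simp: intersection_in_def)
    then show "y' + l \<in> F w" if "y' \<in> F w" for y'
      using closed_convex_translation_invariant[OF _ _ _ that] assms(6)[OF w] by blast
  qed (use that in auto)

  \<comment> \<open>A transversal subspace and a generic direction\<close>
  obtain N where N: "subspace N" "N \<subseteq> E" "dim N \<le> d - k"
    and Ncomp: "\<And>\<sigma> y. \<sigma> \<in> K \<Longrightarrow> y \<in> E \<Longrightarrow> \<exists>n\<in>N. y - n \<in> L \<sigma>"
  proof -
    have "\<exists>N. subspace N \<and> N \<subseteq> E \<and> dim N \<le> d - k \<and> (\<forall>L\<in>L ` K. \<forall>y\<in>E. \<exists>n\<in>N. y - n \<in> L)"
      by (rule exists_common_complement[OF \<open>subspace E\<close>, where k = k])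
        (use \<open>finite K\<close> pL(1,2) LE assms(3,4) in auto)
    then show thesis using that by auto
  qed

  define Q where "Q = (\<lambda>W'. {x + y | x y. x \<in> N \<and> y \<in> VV W'})"
  have subQ: "subspace (Q W')" for W' unfolding Q_def by (intro subspace_sums N(1) subVV)
  define bad where "bad = {W'. W' \<subseteq> W \<and> dim (VV W') < k}"
  have "finite bad" unfolding bad_def using \<open>finite W\<close> by (auto intro: finite_subset[of _ "Pow W"])
  \<comment> \<open>For bad \<open>W'\<close> the dimension of \<open>Q W'\<close> is at most
    \<open>(d - k) + (k - 1) < d\<close>, so \<open>u\<close> can avoid these finitely many proper
    subspaces of \<open>E\<close>.\<close>
  obtain u where u: "u \<in> E" "\<And>W'. W' \<in> bad \<Longrightarrow> u \<notin> Q W'"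
  proof -
    have "\<not> E \<subseteq> Q W'" if "W' \<in> bad" for W'
    proof
      assume "E \<subseteq> Q W'"
      then have "d \<le> dim (Q W')" using dim_subset assms(3) by blast
      moreover have "dim (Q W') \<le> dim N + dim (VV W')"
        using dim_sums_Int[OF N(1) subVV[of W']] unfolding Q_def by linarith
      moreover have "dim (VV W') < k" using that by (simp add: bad_def)
      ultimately show False using N(3) assms(4) by linarith
    qed
    then have "\<exists>u\<in>E. \<forall>R\<in>Q ` bad. u \<notin> R"
      using \<open>finite bad\<close> subQ by (intro exists_vector_avoiding_subspaces[OF \<open>subspace E\<close>]) auto
    then show thesis using that by auto
  qed

  \<comment> \<open>Far translates of \<open>N\<close> avoid the bad intersections\<close>
  obtain R where R: "\<And>\<sigma>. \<sigma> \<in> K \<Longrightarrow> norm (p \<sigma>) \<le> R" "0 \<le> R"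
    using finite_imp_bounded[of "p ` K"] \<open>finite K\<close> unfolding bounded_pos by force

  define near where "near = (\<lambda>w. {x. \<exists>r. norm r \<le> R \<and> x - r \<in> V w})"
  \<comment> \<open>A normal \<open>a\<close> of \<open>Q W'\<close> with
    \<open>a \<bullet> u \<noteq> 0\<close> is bounded on the points of \<open>E\<close> that are
    near all \<open>V w\<close>, but takes the value \<open>t * (a \<bullet> u)\<close> on the whole
    translate of \<open>N\<close> by \<open>t *\<^sub>R u\<close>.\<close>
  have "\<forall>\<^sub>F t in at_top. \<forall>\<nu>\<in>N. t *\<^sub>R u + \<nu> \<notin> (\<Inter>w\<in>W'. near w)" if W': "W' \<in> bad" for W'
  proof -
    have "u \<notin> (Q W')\<^sup>\<bottom>\<^sup>\<bottom>" using u(2)[OF W'] orthogonal_comp_self[OF subQ] by simp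
    then obtain a where a: "a \<in> (Q W')\<^sup>\<bottom>" "a \<bullet> u \<noteq> 0"
      unfolding orthogonal_comp_def[of "(Q W')\<^sup>\<bottom>"] orthogonal_def by blast
    have "N \<subseteq> Q W'" "VV W' \<subseteq> Q W'"
      unfolding Q_def using subspace_0[OF subVV] subspace_0[OF N(1)] by force+
    then have aN: "a \<bullet> \<nu> = 0" if "\<nu> \<in> N" for \<nu>
      using a(1) that by (auto simp: orthogonal_comp_def orthogonal_def inner_commute)
    have "a \<in> (VV W')\<^sup>\<bottom>" using a(1) orthogonal_comp_anti_mono[OF \<open>VV W' \<subseteq> Q W'\<close>] by blast
    then obtain C where C: "\<And>x. (\<forall>V'\<in>insert E (V ` W'). \<exists>r. norm r \<le> R \<and> x - r \<in> V') \<Longrightarrow> \<bar>a \<bullet> x\<bar> \<le> C"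
      using bounded_on_common_neighbourhood[of "insert E (V ` W')" a R] \<open>subspace E\<close>
      unfolding VV_def V_def by auto
    have "t \<le> C / \<bar>a \<bullet> u\<bar>" if "t *\<^sub>R u + \<nu> \<in> (\<Inter>w\<in>W'. near w)" "\<nu> \<in> N" for t \<nu>
    proof -
      have "t *\<^sub>R u + \<nu> \<in> E"
        using u(1) N(2) that(2) \<open>subspace E\<close> by (auto intro: subspace_add subspace_scale)
      then have "\<exists>r. norm r \<le> R \<and> t *\<^sub>R u + \<nu> - r \<in> E"
        using R(2) by (intro exI[of _ 0]) simp
      then have "\<bar>a \<bullet> (t *\<^sub>R u + \<nu>)\<bar> \<le> C"
        using that(1) by (intro C) (auto simp: near_def)
      then have "\<bar>t\<bar> * \<bar>a \<bullet> u\<bar> \<le> C"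
        using aN[OF that(2)] by (simp add: inner_add_right abs_mult)
      then have "\<bar>t\<bar> \<le> C / \<bar>a \<bullet> u\<bar>" using a(2) by (simp add: pos_le_divide_eq)
      then show ?thesis by linarith
    qed
    then show ?thesis
      using eventually_gt_at_top[of "C / \<bar>a \<bullet> u\<bar>"] by (fastforce elim: eventually_mono)
  qed
  then have "\<forall>\<^sub>F t in at_top. \<forall>W'\<in>bad. \<forall>\<nu>\<in>N. t *\<^sub>R u + \<nu> \<notin> (\<Inter>w\<in>W'. near w)"
    using \<open>finite bad\<close> by (intro eventually_ball_finite) auto
  then obtain t where t: "\<And>W' \<nu>. W' \<in> bad \<Longrightarrow> \<nu> \<in> N \<Longrightarrow> t *\<^sub>R u + \<nu> \<notin> (\<Inter>w\<in>W'. near w)"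
    unfolding eventually_at_top_linorder by blast

  \<comment> \<open>Reduction to points in the translate of \<open>N\<close>\<close>
  have "\<exists>q. q - t *\<^sub>R u \<in> N \<and> q - p \<sigma> \<in> L \<sigma>" if \<sigma>: "\<sigma> \<in> K" for \<sigma>
  proof -
    have "p \<sigma> - t *\<^sub>R u \<in> E"
      using pE[OF \<sigma>] u(1) \<open>subspace E\<close> by (intro subspace_diff subspace_scale)
    then obtain n where n: "n \<in> N" "p \<sigma> - t *\<^sub>R u - n \<in> L \<sigma>" using Ncomp[OF \<sigma>] by blast
    have "- (p \<sigma> - t *\<^sub>R u - n) \<in> L \<sigma>" using subspace_neg[OF pL(1)[OF \<sigma>] n(2)] .
    then show ?thesis using n(1) by (intro exI[of _ "t *\<^sub>R u + n"]) (simp add: algebra_simps)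
  qed
  \<comment> \<open>\<open>q \<sigma>\<close> is a common point of the flat of
    \<open>\<sigma>\<close> and the translate of \<open>N\<close>.\<close>
  then obtain q where q: "\<And>\<sigma>. \<sigma> \<in> K \<Longrightarrow> q \<sigma> - t *\<^sub>R u \<in> N" "\<And>\<sigma>. \<sigma> \<in> K \<Longrightarrow> q \<sigma> - p \<sigma> \<in> L \<sigma>"
    by metis
  have qM: "q ` K \<subseteq> (+) (t *\<^sub>R u) ` N"
    using q(1) by (force simp: image_iff intro: bexI[of _ "q _ - t *\<^sub>R u"])
  have "aff_dim (q ` K) \<le> int (d - k)"
    using aff_dim_subset[OF qM] N(1,3) by (simp add: aff_dim_translation_eq aff_dim_subspace)
  from admissible_common_point[OF assms(1,5) this]
  obtain x where x: "{w \<in> W. x \<notin> convex hull (q ` {\<sigma> \<in> K. w \<in> \<sigma>})} \<notin> \<L>" by blast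
  define W' where "W' = {w \<in> W. x \<in> convex hull (q ` {\<sigma> \<in> K. w \<in> \<sigma>})}"
  have "W' \<subseteq> W" "W - W' \<notin> \<L>"
    using x by (auto simp: W'_def set_diff_eq cong: conj_cong)
  have xF: "x \<in> F w" if "w \<in> W'" for w
  proof -
    have "q \<sigma> \<in> F w" if "\<sigma> \<in> K" "w \<in> \<sigma>" for \<sigma>
      using pL(3)[OF that(1) q(2)[OF that(1)]] that(2) by (auto simp: intersection_in_def)
    then have "convex hull (q ` {\<sigma> \<in> K. w \<in> \<sigma>}) \<subseteq> F w"
      using assms(6) \<open>w \<in> W'\<close> by (intro hull_minimal) (auto simp: W'_def)
    then show ?thesis using that by (auto simp: W'_def)
  qed
  \<comment> \<open>\<open>near w\<close> is the sum of a ball and a subspace, hence convex, and it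
    contains \<open>q \<sigma>\<close> for \<open>w \<in> \<sigma>\<close>, since
    \<open>q \<sigma> - p \<sigma>\<close> lies in
    \<open>L \<sigma> \<subseteq> V w\<close>.\<close>
  have xnear: "x \<in> near w" if "w \<in> W'" for w
  proof -
    have "near w = (\<Union>r\<in>cball 0 R. \<Union>v\<in>V w. {r + v})"
    proof (intro set_eqI iffI)
      fix y assume "y \<in> near w"
      then obtain r where "r \<in> cball 0 R" "y - r \<in> V w" by (auto simp: near_def)
      then show "y \<in> (\<Union>r\<in>cball 0 R. \<Union>v\<in>V w. {r + v})"
        by (intro UN_I[of r] UN_I[of "y - r"]) auto
    qed (force simp: near_def)
    moreover have "convex (V w)" by (simp add: V_def subspace_imp_convex)
    ultimately have "convex (near w)"
      using convex_sums[of "cball 0 R" "V w"] by simp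
    moreover have "q \<sigma> \<in> near w" if "\<sigma> \<in> K" "w \<in> \<sigma>" for \<sigma>
      using R(1)[OF that(1)] q(2)[OF that(1)] that unfolding near_def V_def
      by (auto intro: span_base)
    ultimately have "convex hull (q ` {\<sigma> \<in> K. w \<in> \<sigma>}) \<subseteq> near w"
      by (intro hull_minimal) auto
    then show ?thesis using that by (auto simp: W'_def)
  qed

  \<comment> \<open>The flat in the intersection\<close>
  have "k \<le> dim (VV W')"
  proof (rule ccontr)
    assume "\<not> k \<le> dim (VV W')"
    then have bad: "W' \<in> bad" using \<open>W' \<subseteq> W\<close> by (simp add: bad_def)
    \<comment> \<open>Only an index in \<open>W'\<close> shows that \<open>x\<close> lies in the
      translate of \<open>N\<close>; for empty \<open>W'\<close>, \<open>VV W'\<close> is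
      \<open>E\<close>, of dimension \<open>d \<ge> k\<close>.\<close>
    have "W' \<noteq> {}"
      using \<open>\<not> k \<le> dim (VV W')\<close> assms(3,4) by (auto simp: VV_def)
    then obtain w where "w \<in> W'" by blast
    then have "x \<in> convex hull ((+) (t *\<^sub>R u) ` N)"
      using hull_mono[of "q ` {\<sigma> \<in> K. w \<in> \<sigma>}" "(+) (t *\<^sub>R u) ` N"] qM by (auto simp: W'_def)
    moreover have "convex ((+) (t *\<^sub>R u) ` N)"
      using N(1) by (simp add: convex_translation subspace_imp_convex)
    ultimately obtain \<nu> where "\<nu> \<in> N" "x = t *\<^sub>R u + \<nu>" by (auto simp: hull_same)
    then show False using t[OF bad] xnear by blast
  qed
  then obtain P where P: "subspace P" "P \<subseteq> span (VV W')" "dim P = k"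
    by (rule choose_subspace_of_subspace)
  then have PV: "P \<subseteq> VV W'" using subVV by (metis span_eq_iff)
  \<comment> \<open>For empty \<open>W'\<close> the point \<open>x\<close> may lie outside
    \<open>E\<close>, so \<open>0\<close> is the base point.\<close>
  define y where "y = (if W' = {} then 0 else x)"
  have yF: "y \<in> F w" if "w \<in> W'" for w using xF that by (auto simp: y_def)
  have yE: "y \<in> E"
    using xF \<open>W' \<subseteq> W\<close> assms(6) subspace_0[OF \<open>subspace E\<close>] by (fastforce simp: y_def)
  have "is_flat k ((+) y ` P)"
    unfolding is_flat_def using P(1,3)
    by (simp add: affine_translation[symmetric] subspace_imp_affine aff_dim_translation_eq aff_dim_subspace)
  moreover have "(+) y ` P \<subseteq> intersection_in E F W'"
  proof
    fix z assume "z \<in> (+) y ` P"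
    then obtain v where v: "z = y + v" "v \<in> VV W'" using PV by blast
    then have "v \<in> E" "\<And>w. w \<in> W' \<Longrightarrow> v \<in> V w" by (auto simp: VV_def)
    then show "z \<in> intersection_in E F W'"
      using v(1) yE yF VF \<open>W' \<subseteq> W\<close> subspace_add[OF \<open>subspace E\<close>]
      by (auto simp: intersection_in_def)
  qed
  ultimately show ?thesis
    using \<open>W' \<subseteq> W\<close> \<open>W - W' \<notin> \<L>\<close> unfolding contains_flat_def by blast
qed

end
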